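(* Let $n\geq 2$ and let $a_1,\ldots,a_n\in\mathbb Z$. Consider the congruence $a_1x_1+\ldots+a_nx_n\equiv 1\pmod n$. (1) If $n$ is odd or some $a_i$ is even, then the congruence has a solution $(x_1,\ldots,x_n)\in\mathbb Z^n$ with the $x_i$ pairwise distinct modulo $n$ if and only if $\gcd(a_2-a_1,a_3-a_1,\ldots,a_n-a_1,n)=1$. (2) If $n\equiv 0\pmod 4$ and all $a_i$ are odd, then the congruence has no solution $(x_1,\ldots,x_n)\in\mathbb Z^n$ with the $x_i$ pairwise distinct modulo $n$. (3) If $n\equiv 2\pmod 4$ and all $a_i$ are odd, then the congruence has a solution $(x_1,\ldots,x_n)\in\mathbb Z^n$ with the $x_i$ pairwise distinct modulo $n$ if and only if $\gcd(a_2-a_1,a_3-a_1,\ldots,a_n-a_1,n)=2$. *)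

theory Defs
  imports "HOL-Number_Theory.Number_Theory"
begin

text \<open>Tuples in \<open>\<int>\<^sup>n\<close> are functions \<^typ>\<open>nat \<Rightarrow> int\<close> of which only the values
  at the indices \<open>1, \<dots>, n\<close> are used.\<close>

definition distinct_mod :: "nat \<Rightarrow> (nat \<Rightarrow> int) \<Rightarrow> bool" where
  "distinct_mod n x \<longleftrightarrow>
     (\<forall>i\<in>{1..n}. \<forall>j\<in>{1..n}. i \<noteq> j \<longrightarrow> \<not> [x i = x j] (mod int n))"

definition has_distinct_solution :: "nat \<Rightarrow> (nat \<Rightarrow> int) \<Rightarrow> bool" where
  "has_distinct_solution n a \<longleftrightarrow>
     (\<exists>x :: nat \<Rightarrow> int. distinct_mod n x \<and> [(\<Sum>i=1..n. a i * x i) = 1] (mod int n))"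

definition diff_gcd :: "nat \<Rightarrow> (nat \<Rightarrow> int) \<Rightarrow> int" where
  "diff_gcd n a = Gcd (insert (int n) ((\<lambda>i. a i - a 1) ` {2..n}))"

end

theory Submission
  imports Defs "HOL-Combinatorics.Transposition"
begin

text \<open>
  Up to scaling by a unit, a distinct solution is a bijection \<open>x\<close> from \<open>{1..n}\<close> to \<open>{0..<n}\<close> for
  which \<open>\<Sum> a\<^sub>i x\<^sub>i\<close> is nonzero modulo every prime divisor of \<open>n\<close>. Such an \<open>x\<close> is built one prime
  at a time, smallest first: given the residues of \<open>x\<close> modulo \<open>M\<close>, each of their fibres is cut into
  \<open>p\<close> equal parts, which fixes \<open>x\<close> modulo \<open>M p\<close>. The invariant is that for each prime \<open>q\<close> still to
  come, \<open>a\<close> is not constant modulo \<open>q\<close> on some fibre. If the sum happens to vanish modulo \<open>p\<close>,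
  exchange two indices of one fibre that lie in different parts and have different \<open>a\<close> modulo \<open>p\<close>.
  Between two parts of size \<open>s\<close> there are either no such exchanges or at least \<open>s\<close> of them, while
  each later \<open>q\<close> has its invariant destroyed by at most one; as \<open>s\<close> is at least the product of the
  later primes, it exceeds their number, so a harmless exchange exists.

  Conversely, modulo \<open>d = gcd(a\<^sub>2 - a\<^sub>1, \<dots>, n)\<close> the sum is \<open>a\<^sub>1 n(n - 1)/2\<close>, and twice this
  vanishes, so a solution forces \<open>d\<close> to divide 2; parity decides the rest.
\<close>

section \<open>Labellings with equal fibres\<close>

text \<open>\<open>f\<close> stands for the residues of \<open>x\<close> fixed so far. The labelling
  \<open>\<lambda>_. ()\<close> turns this into nonconstancy on all of \<open>I\<close>.\<close>

definition nonconst :: "('i \<Rightarrow> int) \<Rightarrow> 'i set \<Rightarrow> ('i \<Rightarrow> 'b) \<Rightarrow> nat \<Rightarrow> bool" where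
  "nonconst a I f q \<longleftrightarrow> (\<exists>i\<in>I. \<exists>j\<in>I. f i = f j \<and> \<not> [a i = a j] (mod int q))"

text \<open>The size is required only of fibres that meet \<open>I\<close>, so no codomain has to be
  named; \<open>s = 1\<close> means injectivity on \<open>I\<close>.\<close>

definition equi_fibres :: "('i \<Rightarrow> 'b) \<Rightarrow> 'i set \<Rightarrow> nat \<Rightarrow> bool" where
  "equi_fibres f I s \<longleftrightarrow> (\<forall>i\<in>I. card {j\<in>I. f j = f i} = s)"

lemma equi_fibres_transpose:
  assumes "i \<in> I" "j \<in> I" "equi_fibres f I s"
  shows "equi_fibres (f \<circ> transpose i j) I s"
  unfolding equi_fibres_def
proof
  fix l assume l: "l \<in> I"
  have mem: "transpose i j k \<in> I \<longleftrightarrow> k \<in> I" for k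
    using assms by (auto simp: transpose_def)
  have "{k\<in>I. (f \<circ> transpose i j) k = (f \<circ> transpose i j) l}
      = transpose i j ` {k\<in>I. f k = f (transpose i j l)}"
  proof (intro Set.set_eqI iffI)
    fix k assume "k \<in> {k\<in>I. (f \<circ> transpose i j) k = (f \<circ> transpose i j) l}"
    then show "k \<in> transpose i j ` {k\<in>I. f k = f (transpose i j l)}"
      using mem by (intro image_eqI[of _ _ "transpose i j k"]) auto
  qed (use mem in auto)
  then have "card {k\<in>I. (f \<circ> transpose i j) k = (f \<circ> transpose i j) l}
      = card {k\<in>I. f k = f (transpose i j l)}"
    by (simp add: card_image)
  then show "card {k\<in>I. (f \<circ> transpose i j) k = (f \<circ> transpose i j) l} = s"
    using assms(3) l mem unfolding equi_fibres_def by auto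
qed

text \<open>\<open>B\<close> is enlarged to a part of size \<open>s\<close> carrying the top label;
  induction splits the rest, with nothing left to keep together.\<close>

lemma equipartition_const_on:
  assumes "finite A" "card A = p * s" "B \<subseteq> A" "card B \<le> s"
  shows "\<exists>t :: 'i \<Rightarrow> nat. (\<forall>i\<in>A. t i < p) \<and> equi_fibres t A s \<and> (\<forall>i\<in>B. \<forall>j\<in>B. t i = t j)"
  using assms
proof (induction p arbitrary: A B)
  case 0
  then show ?case by (auto simp: equi_fibres_def)
next
  case (Suc p)
  obtain B' where B': "B \<subseteq> B'" "B' \<subseteq> A" "card B' = s"
    using exists_subset_between[of B s A] Suc.prems by auto
  have "card (A - B') = p * s"
    using Suc.prems B' by (subst card_Diff_subset) (auto intro: finite_subset)
  then obtain t :: "'i \<Rightarrow> nat" where t: "\<forall>i\<in>A - B'. t i < p" "equi_fibres t (A - B') s"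
    using Suc.IH[of "A - B'" "{}"] Suc.prems by auto
  define t' where "t' = (\<lambda>i. if i \<in> B' then p else t i)"
  have "card {j\<in>A. t' j = t' i} = s" if "i \<in> A" for i
  proof (cases "i \<in> B'")
    case True
    then have "{j\<in>A. t' j = t' i} = B'" using B' t by (auto simp: t'_def)
    then show ?thesis using B' by simp
  next
    case False
    then have "{j\<in>A. t' j = t' i} = {j\<in>A - B'. t j = t i}"
      using B' t that by (auto simp: t'_def)
    then show ?thesis using t(2) that False by (simp add: equi_fibres_def)
  qed
  then show ?case
    using B' t by (intro exI[of _ t']) (auto simp: equi_fibres_def t'_def less_Suc_eq)
qed

section \<open>Exchanges between two fibres\<close>

text \<open>Fibres of size two would break this: with residues 0 and 1 in both, exchanging the 0 of
  the first with the 1 of the second, or the 1 with the 0, makes each fibre constant. A third index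
  reveals the majority value.\<close>

lemma transposition_destroys_unique:
  assumes nc: "nonconst a I f q" and "u \<noteq> v" and "card {l\<in>I. f l = u} \<ge> 3"
    and m: "i \<in> I" "f i = u" "j \<in> I" "f j = v" "i' \<in> I" "f i' = u" "j' \<in> I" "f j' = v"
    and d: "\<not> nonconst a I (f \<circ> transpose i j) q" "\<not> nonconst a I (f \<circ> transpose i' j') q"
  shows "i = i' \<and> j = j'"
proof -
  define b where "b = (\<lambda>l. a l mod int q)"
  have d1: "b l = b k" if "l \<in> I" "k \<in> I" "f (transpose i j l) = f (transpose i j k)" for l k
    using d(1) that unfolding nonconst_def b_def cong_def comp_def by blast
  have d2: "b l = b k" if "l \<in> I" "k \<in> I" "f (transpose i' j' l) = f (transpose i' j' k)" for l k
    using d(2) that unfolding nonconst_def b_def cong_def comp_def by blast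
  \<comment> \<open>After the exchange \<open>j\<close> carries the label \<open>u\<close> and
    \<open>i\<close> the label \<open>v\<close>, so the indices that stayed in a fibre agree with
    its newcomer.\<close>
  have A1: "b l = b j" if "l \<in> I" "f l = u" "l \<noteq> i" for l
  proof -
    have "transpose i j l = l" using that m \<open>u \<noteq> v\<close> by (metis transpose_apply_other)
    then show ?thesis using d1[of l j] that m by simp
  qed
  have B1: "b l = b i" if "l \<in> I" "f l = v" "l \<noteq> j" for l
  proof -
    have "transpose i j l = l" using that m \<open>u \<noteq> v\<close> by (metis transpose_apply_other)
    then show ?thesis using d1[of l i] that m by simp
  qed
  have A2: "b l = b j'" if "l \<in> I" "f l = u" "l \<noteq> i'" for l
  proof -
    have "transpose i' j' l = l" using that m \<open>u \<noteq> v\<close> by (metis transpose_apply_other)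
    then show ?thesis using d2[of l j'] that m by simp
  qed
  \<comment> \<open>With equal values the exchange would leave the residues in every fibre as they
    were, so it could not destroy \<open>nc\<close>.\<close>
  have ne: "b i \<noteq> b j"
  proof
    assume eq: "b i = b j"
    obtain l k where lk: "l \<in> I" "k \<in> I" "f l = f k" "b l \<noteq> b k"
      using nc unfolding nonconst_def b_def cong_def by blast
    consider "f l = u" | "f l = v" | "f l \<noteq> u" "f l \<noteq> v" by blast
    then show False
    proof cases
      case 1
      then show False using A1[of l] A1[of k] lk eq by metis
    next
      case 2
      then show False using B1[of l] B1[of k] lk eq by metis
    next
      case 3
      then have "transpose i j l = l" "transpose i j k = k"
        using lk m by (auto simp: transpose_def)
      then show False using d1[of l k] lk by auto
    qed
  qed
  \<comment> \<open>So \<open>b\<close> is \<open>b j\<close> on the fibre of \<open>u\<close> except at \<open>i\<close>, and \<open>b i\<close> on the fibre of \<open>v\<close> except at \<open>j\<close>;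
    with three elements in a fibre the exceptional index is determined.\<close>
  have "\<not> {l\<in>I. f l = u} \<subseteq> {i, i'}"
  proof
    assume "{l\<in>I. f l = u} \<subseteq> {i, i'}"
    then have "card {l\<in>I. f l = u} \<le> card {i, i'}" by (intro card_mono) auto
    also have "\<dots> \<le> 2" by (simp add: card_insert_if)
    finally show False using assms(3) by simp
  qed
  then obtain l where l: "l \<in> I" "f l = u" "l \<noteq> i" "l \<noteq> i'" by blast
  \<comment> \<open>\<open>l\<close> gives \<open>b j = b j'\<close>. Then
    \<open>i \<noteq> i'\<close> would force \<open>b i = b j'\<close>, and
    \<open>j \<noteq> j'\<close> would force \<open>b j' = b i\<close>, both against
    \<open>ne\<close>.\<close>
  show ?thesis
    using ne A1[of l] A2[of l] A2[of i] B1[of j'] l m by metis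
qed

text \<open>Pigeonhole: if every pair in \<open>E\<close> ruined some prime, \<open>h\<close> would
  pick one for each pair; by uniqueness \<open>h\<close> is injective, leaving at most
  \<open>card Q < s\<close> pairs, too few. The bound 3 is asked for only when \<open>Q\<close> is
  nonempty, because the last prime may leave parts of size 1.\<close>

lemma exists_harmless_transposition:
  assumes fin: "finite I" "finite Q" and eq: "equi_fibres f I s" and uv: "u \<noteq> v"
    and w: "i0 \<in> I" "f i0 = u" "j0 \<in> I" "f j0 = v" "\<not> [a i0 = a j0] (mod int p)"
    and nc: "\<And>q. q \<in> Q \<Longrightarrow> nonconst a I f q"
    and s: "card Q < s" "Q \<noteq> {} \<Longrightarrow> s \<ge> 3"
  shows "\<exists>i\<in>I. \<exists>j\<in>I. f i = u \<and> f j = v \<and> \<not> [a i = a j] (mod int p) \<and>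
           (\<forall>q\<in>Q. nonconst a I (f \<circ> transpose i j) q)"
proof (rule ccontr)
  assume contr: "\<not> ?thesis"
  define A where "A = {l\<in>I. f l = u}"
  define B where "B = {l\<in>I. f l = v}"
  define E where "E = {(i, j). i \<in> A \<and> j \<in> B \<and> \<not> [a i = a j] (mod int p)}"
  have card: "card A = s" "card B = s"
    using eq w by (auto simp: equi_fibres_def A_def B_def)
  have finAB: "finite A" "finite B" using fin by (auto simp: A_def B_def)
  have finE: "finite E"
    by (rule finite_subset[of _ "A \<times> B"]) (use finAB in \<open>auto simp: E_def\<close>)
  \<comment> \<open>Either each index of \<open>A\<close> has a partner in \<open>B\<close>, or some
    \<open>k\<close> is congruent to all of \<open>B\<close>; then \<open>B\<close> has a single
    residue, and \<open>i0\<close>, which differs from \<open>j0\<close>, pairs with all of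
    \<open>B\<close>.\<close>
  have "s \<le> card E"
  proof (cases "\<forall>i\<in>A. \<exists>j\<in>B. \<not> [a i = a j] (mod int p)")
    case True
    then obtain g where g: "\<And>i. i \<in> A \<Longrightarrow> g i \<in> B \<and> \<not> [a i = a (g i)] (mod int p)"
      by metis
    have "card ((\<lambda>i. (i, g i)) ` A) \<le> card E"
      using finE g by (intro card_mono) (auto simp: E_def)
    then show ?thesis by (simp add: card_image inj_on_def card)
  next
    case False
    then obtain k where k: "\<And>j. j \<in> B \<Longrightarrow> [a k = a j] (mod int p)" by blast
    have "\<not> [a i0 = a j] (mod int p)" if "j \<in> B" for j
      using k[OF that] k[of j0] w by (auto simp: B_def cong_def)
    then have "card (Pair i0 ` B) \<le> card E"
      using finE w by (intro card_mono) (auto simp: E_def A_def)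
    then show ?thesis by (simp add: card_image inj_on_def card)
  qed
  moreover have "\<exists>q\<in>Q. \<not> nonconst a I (f \<circ> transpose (fst e) (snd e)) q" if "e \<in> E" for e
    using contr that unfolding E_def A_def B_def by fastforce
  then obtain h where h: "\<And>e. e \<in> E \<Longrightarrow>
      h e \<in> Q \<and> \<not> nonconst a I (f \<circ> transpose (fst e) (snd e)) (h e)"
    by metis
  have "inj_on h E"
  proof (rule inj_onI)
    fix e e' assume e: "e \<in> E" "e' \<in> E" "h e = h e'"
    have "card {l\<in>I. f l = u} \<ge> 3" using h[of e] e s(2) card by (auto simp: A_def)
    then have "fst e = fst e' \<and> snd e = snd e'"
      using h[of e] h[of e'] e nc[of "h e"] uv
      by (intro transposition_destroys_unique[of a I f "h e" u v]) (auto simp: E_def A_def B_def)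
    then show "e = e'" by (simp add: prod_eq_iff)
  qed
  then have "card E \<le> card Q"
    using h fin by (intro card_inj_on_le) auto
  ultimately show False using s by simp
qed

section \<open>Refinement at one prime\<close>

lemma equipartition_nonconst:
  assumes "finite A" "card A = p * s" "finite Q" "card Q < s"
  shows "\<exists>t :: 'i \<Rightarrow> nat. (\<forall>i\<in>A. t i < p) \<and> equi_fibres t A s \<and>
    (\<forall>q\<in>Q. nonconst a A (\<lambda>_. ()) q \<longrightarrow> nonconst a A t q)"
proof (cases "A = {}")
  case True
  then show ?thesis by (auto simp: equi_fibres_def nonconst_def)
next
  case False
  then obtain b where b: "b \<in> A" by blast
  define Q' where "Q' = {q\<in>Q. nonconst a A (\<lambda>_. ()) q}"
  \<comment> \<open>A common base point \<open>b\<close> leaves at most \<open>card Q + 1 \<le> s\<close> indices to be kept together.\<close>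
  have "\<exists>j\<in>A. \<not> [a j = a b] (mod int q)" if "q \<in> Q'" for q
  proof (rule ccontr)
    assume "\<not> (\<exists>j\<in>A. \<not> [a j = a b] (mod int q))"
    then have "[a i = a j] (mod int q)" if "i \<in> A" "j \<in> A" for i j
      using that by (meson cong_sym cong_trans)
    then show False using that by (auto simp: Q'_def nonconst_def)
  qed
  then obtain g where g: "\<And>q. q \<in> Q' \<Longrightarrow> g q \<in> A \<and> \<not> [a (g q) = a b] (mod int q)" by metis
  have Q': "finite Q'" "card Q' \<le> card Q"
    using assms by (auto simp: Q'_def intro: card_mono)
  have "card (insert b (g ` Q')) \<le> Suc (card (g ` Q'))" by (simp add: card_insert_if Q')
  also have "\<dots> \<le> s" using card_image_le[of Q' g] Q' assms by linarith
  finally have "card (insert b (g ` Q')) \<le> s" .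
  moreover have "insert b (g ` Q') \<subseteq> A" using b g by auto
  ultimately obtain t :: "'i \<Rightarrow> nat" where t: "\<forall>i\<in>A. t i < p" "equi_fibres t A s"
    "\<forall>i\<in>insert b (g ` Q'). \<forall>j\<in>insert b (g ` Q'). t i = t j"
    using equipartition_const_on[OF assms(1,2)] by metis
  have "nonconst a A t q" if "q \<in> Q'" for q
    unfolding nonconst_def using g[OF that] b t(3) that by blast
  then show ?thesis using t by (auto simp: Q'_def)
qed

text \<open>Each fibre of \<open>f\<close> is split separately. The conditional conclusion of the
  splitting lets all of \<open>Q\<close> be treated on every fibre at once, and each
  \<open>q\<close> meets the condition on some fibre.\<close>

lemma equi_refinement_nonconst:
  fixes f :: "'i \<Rightarrow> 'b"
  assumes fin: "finite I" "finite Q" and eq: "equi_fibres f I (p * s)" and "card Q < s"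
    and nc: "\<And>q. q \<in> Q \<Longrightarrow> nonconst a I f q"
  shows "\<exists>t :: 'i \<Rightarrow> nat. (\<forall>i\<in>I. t i < p) \<and> equi_fibres (\<lambda>i. (f i, t i)) I s \<and>
    (\<forall>q\<in>Q. nonconst a I (\<lambda>i. (f i, t i)) q)"
proof -
  define F where "F = (\<lambda>c. {i\<in>I. f i = c})"
  have "\<exists>t :: 'i \<Rightarrow> nat. (\<forall>i\<in>F c. t i < p) \<and> equi_fibres t (F c) s \<and>
    (\<forall>q\<in>Q. nonconst a (F c) (\<lambda>_. ()) q \<longrightarrow> nonconst a (F c) t q)" if "c \<in> f ` I" for c
    using that assms by (intro equipartition_nonconst) (auto simp: F_def equi_fibres_def)
  then obtain T :: "'b \<Rightarrow> 'i \<Rightarrow> nat" where T: "\<And>c. c \<in> f ` I \<Longrightarrow>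
    (\<forall>i\<in>F c. T c i < p) \<and> equi_fibres (T c) (F c) s \<and>
    (\<forall>q\<in>Q. nonconst a (F c) (\<lambda>_. ()) q \<longrightarrow> nonconst a (F c) (T c) q)" by metis
  define t where "t = (\<lambda>i. T (f i) i)"
  have "t i < p" if "i \<in> I" for i
    using T[of "f i"] that by (auto simp: t_def F_def)
  moreover have "card {j\<in>I. (f j, t j) = (f i, t i)} = s" if "i \<in> I" for i
  proof -
    have "{j\<in>I. (f j, t j) = (f i, t i)} = {j\<in>F (f i). T (f i) j = T (f i) i}"
      by (auto simp: t_def F_def)
    then show ?thesis using T[of "f i"] that by (auto simp: equi_fibres_def F_def)
  qed
  moreover have "nonconst a I (\<lambda>i. (f i, t i)) q" if q: "q \<in> Q" for q
  proof -
    obtain i j where ij: "i \<in> I" "j \<in> I" "f i = f j" "\<not> [a i = a j] (mod int q)"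
      using nc[OF q] by (auto simp: nonconst_def)
    then have "nonconst a (F (f i)) (\<lambda>_. ()) q" by (auto simp: nonconst_def F_def)
    then have "nonconst a (F (f i)) (T (f i)) q" using T[of "f i"] ij q by blast
    then obtain k l where "k \<in> F (f i)" "l \<in> F (f i)" "T (f i) k = T (f i) l"
      "\<not> [a k = a l] (mod int q)" by (auto simp: nonconst_def)
    then show ?thesis unfolding nonconst_def
      by (intro bexI[of _ k] bexI[of _ l]) (auto simp: t_def F_def)
  qed
  ultimately show ?thesis by (intro exI[of _ t]) (auto simp: equi_fibres_def)
qed

lemma sum_transpose_diff:
  fixes a z :: "'i \<Rightarrow> int"
  assumes "finite I" "i \<in> I" "j \<in> I" "i \<noteq> j"
  shows "(\<Sum>l\<in>I. a l * z (transpose i j l)) = (\<Sum>l\<in>I. a l * z l) + (a i - a j) * (z j - z i)"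
proof -
  have I: "I = insert i (insert j (I - {i, j}))" using assms by auto
  have "(\<Sum>l\<in>I - {i, j}. a l * z (transpose i j l)) = (\<Sum>l\<in>I - {i, j}. a l * z l)"
    by (intro sum.cong) (auto simp: transpose_def)
  then show ?thesis
    using assms by (subst (1 2) I) (simp add: algebra_simps)
qed

text \<open>Exchanging \<open>i\<close> and \<open>j\<close> inside a fibre of \<open>f\<close>
  changes the sum by \<open>(a i - a j) * M * (t j - t i)\<close>. For a suitable pair
  \<open>p\<close> divides none of the factors, so a sum that was zero becomes nonzero.\<close>

lemma refine_at_prime:
  fixes f :: "'i \<Rightarrow> nat"
  assumes fin: "finite I" "finite Q" and eq: "equi_fibres f I (p * s)"
    and p: "prime p" "coprime p M"
    and s: "card Q < s" "Q \<noteq> {} \<Longrightarrow> s \<ge> 3"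
    and nc: "\<And>q. q \<in> Q \<Longrightarrow> nonconst a I f q" and ncp: "nonconst a I f p"
  shows "\<exists>t :: 'i \<Rightarrow> nat. (\<forall>i\<in>I. t i < p) \<and> equi_fibres (\<lambda>i. (f i, t i)) I s \<and>
    (\<forall>q\<in>Q. nonconst a I (\<lambda>i. (f i, t i)) q) \<and>
    \<not> [(\<Sum>i\<in>I. a i * int (f i + M * t i)) = 0] (mod int p)"
proof -
  obtain t :: "'i \<Rightarrow> nat" where t: "\<forall>i\<in>I. t i < p" "equi_fibres (\<lambda>i. (f i, t i)) I s"
    "\<And>q. q \<in> Q \<Longrightarrow> nonconst a I (\<lambda>i. (f i, t i)) q"
    using equi_refinement_nonconst[OF fin eq s(1) nc] by blast
  show ?thesis
  proof (cases "[(\<Sum>i\<in>I. a i * int (f i + M * t i)) = 0] (mod int p)")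
    case False
    then show ?thesis using t by blast
  next
    case zero: True
    obtain i1 j1 where ij1: "i1 \<in> I" "j1 \<in> I" "f i1 = f j1" "\<not> [a i1 = a j1] (mod int p)"
      using ncp by (auto simp: nonconst_def)
    \<comment> \<open>If \<open>i1\<close> and \<open>j1\<close> fell into the same part, an index
      \<open>k\<close> of their fibre in another part still differs modulo \<open>p\<close> from at
      least one of them.\<close>
    have "\<exists>i0 j0. i0 \<in> I \<and> j0 \<in> I \<and> f i0 = f j0 \<and> t i0 \<noteq> t j0 \<and> \<not> [a i0 = a j0] (mod int p)"
    proof (cases "t i1 = t j1")
      case True
      have "card {k\<in>I. f k = f i1} = p * s" "card {k\<in>I. (f k, t k) = (f i1, t i1)} = s"
        using eq t(2) ij1 by (auto simp: equi_fibres_def)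
      moreover have "s < p * s" using prime_gt_1_nat[OF p(1)] s(1) by simp
      ultimately have "{k\<in>I. f k = f i1} \<noteq> {k\<in>I. (f k, t k) = (f i1, t i1)}" by force
      then obtain k where k: "k \<in> I" "f k = f i1" "t k \<noteq> t i1" by auto
      then have "\<not> [a k = a i1] (mod int p) \<or> \<not> [a k = a j1] (mod int p)"
        using ij1 by (auto simp: cong_def)
      then show ?thesis using k ij1 True by metis
    qed (use ij1 in blast)
    then obtain i0 j0 where ij0: "i0 \<in> I" "j0 \<in> I" "f i0 = f j0" "t i0 \<noteq> t j0"
      "\<not> [a i0 = a j0] (mod int p)" by blast
    define g where "g = (\<lambda>i. (f i, t i))"
    have "\<exists>i\<in>I. \<exists>j\<in>I. g i = g i0 \<and> g j = g j0 \<and> \<not> [a i = a j] (mod int p) \<and>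
           (\<forall>q\<in>Q. nonconst a I (g \<circ> transpose i j) q)"
      using ij0 t s by (intro exists_harmless_transposition[OF fin, of g s _ _ i0 j0])
        (auto simp: g_def)
    then obtain i j where ij: "i \<in> I" "j \<in> I" "g i = g i0" "g j = g j0"
      "\<not> [a i = a j] (mod int p)" "\<forall>q\<in>Q. nonconst a I (g \<circ> transpose i j) q" by blast
    have fij: "f i = f j" "t i \<noteq> t j" using ij ij0 by (auto simp: g_def)
    define t' where "t' = t \<circ> transpose i j"
    have ft: "f (transpose i j k) = f k" for k using fij by (auto simp: transpose_def)
    have g': "(\<lambda>k. (f k, t' k)) = g \<circ> transpose i j"
      by (auto simp: g_def t'_def ft)
    have "t' k < p" if "k \<in> I" for k
      using t(1) ij that by (auto simp: t'_def transpose_def)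
    moreover have "equi_fibres (g \<circ> transpose i j) I s"
      using equi_fibres_transpose[OF ij(1,2)] t(2) by (auto simp: g_def)
    moreover have "\<not> [(\<Sum>k\<in>I. a k * int (f k + M * t' k)) = 0] (mod int p)"
    proof
      assume "[(\<Sum>k\<in>I. a k * int (f k + M * t' k)) = 0] (mod int p)"
      moreover have "(\<Sum>k\<in>I. a k * int (f k + M * t' k)) =
        (\<Sum>k\<in>I. a k * int (f k + M * t k)) + (a i - a j) * (int M * (int (t j) - int (t i)))"
      proof -
        have "i \<noteq> j" using fij by auto
        then show ?thesis
          using sum_transpose_diff[of I i j a "\<lambda>k. int (f k + M * t k)"] fin ij fij
          by (simp add: t'_def ft algebra_simps)
      qed
      ultimately have "int p dvd (a i - a j) * (int M * (int (t j) - int (t i)))"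
        using zero by (simp only: cong_0_iff dvd_add_right_iff)
      then have "int p dvd a i - a j \<or> int p dvd int M \<or> int p dvd int (t j) - int (t i)"
        using p(1) by (simp add: prime_dvd_mult_iff)
      moreover have "\<not> int p dvd a i - a j" using ij(5) by (simp add: cong_iff_dvd_diff)
      moreover have "\<not> int p dvd int M"
        using p by (metis coprime_absorb_left not_prime_unit of_nat_dvd_iff)
      moreover have "\<not> int p dvd int (t j) - int (t i)"
      proof
        assume "int p dvd int (t j) - int (t i)"
        then have "[t j = t i] (mod p)" by (simp add: cong_iff_dvd_diff flip: cong_int_iff)
        then show False using t(1) ij(1,2) fij(2) by (auto simp: cong_def)
      qed
      ultimately show False by blast
    qed
    ultimately show ?thesis using ij(6) unfolding g'[symmetric] by blast
  qed
qed

section \<open>Mixed radix and induction over the primes\<close>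

lemma equi_fibres_mixed_radix:
  fixes f t :: "'i \<Rightarrow> nat"
  assumes "\<And>i. i \<in> I \<Longrightarrow> f i < M" "equi_fibres (\<lambda>i. (f i, t i)) I s"
  shows "equi_fibres (\<lambda>i. f i + M * t i) I s"
proof -
  have "f j + M * t j = f i + M * t i \<longleftrightarrow> (f j, t j) = (f i, t i)" if "i \<in> I" "j \<in> I" for i j
  proof
    assume eq: "f j + M * t j = f i + M * t i"
    have "(f j + M * t j) mod M = f j" "(f i + M * t i) mod M = f i"
      using assms(1) that by auto
    then have "f j = f i" using eq by simp
    moreover have "M > 0" using assms(1)[OF that(1)] by simp
    ultimately show "(f j, t j) = (f i, t i)" using eq by simp
  qed auto
  then have "{j\<in>I. f j + M * t j = f i + M * t i} = {j\<in>I. (f j, t j) = (f i, t i)}" if "i \<in> I" for i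
    using that by blast
  then show ?thesis using assms(2) by (simp add: equi_fibres_def)
qed

lemma mixed_radix_less:
  fixes f t M p :: nat
  assumes "f < M" "t < p"
  shows "f + M * t < M * p"
proof -
  have "f + M * t < M * Suc t" using assms by simp
  also have "\<dots> \<le> M * p" using assms by (intro mult_le_mono) auto
  finally show ?thesis .
qed

lemma nonconst_mixed_radix:
  fixes f t :: "'i \<Rightarrow> nat"
  assumes "nonconst a I (\<lambda>i. (f i, t i)) q"
  shows "nonconst a I (\<lambda>i. f i + M * t i) q"
  using assms unfolding nonconst_def prod.inject by metis

text \<open>With \<open>k < 2 ^ k\<close> this makes the part size exceed the number of primes still
  to come.\<close>

lemma two_power_card_le_prod:
  fixes Q :: "nat set"
  assumes "finite Q" "\<And>q. q \<in> Q \<Longrightarrow> q \<ge> 2"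
  shows "2 ^ card Q \<le> \<Prod>Q"
  using prod_mono[of Q "\<lambda>_. 2 :: nat" "\<lambda>q. q"] assms by simp

text \<open>The clause \<open>[g i = f i] (mod M)\<close> carries the induction: later refinements
  work modulo \<open>M * p\<close>, so they preserve the sum modulo \<open>p\<close> and its
  nonvanishing. The factor \<open>s\<close> is the cofactor left after all primes.\<close>

lemma refine_at_primes:
  fixes f :: "'i \<Rightarrow> nat" and Q :: "nat set"
  assumes "finite Q" "finite I" "\<And>q. q \<in> Q \<Longrightarrow> prime q" "\<And>q. q \<in> Q \<Longrightarrow> coprime q M"
    and "\<And>i. i \<in> I \<Longrightarrow> f i < M" "equi_fibres f I (\<Prod>Q * s)" "s > 0"
    and "\<And>q. q \<in> Q \<Longrightarrow> nonconst a I f q"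
  shows "\<exists>g :: 'i \<Rightarrow> nat. (\<forall>i\<in>I. g i < M * \<Prod>Q \<and> [g i = f i] (mod M)) \<and> equi_fibres g I s \<and>
    (\<forall>q\<in>Q. \<not> [(\<Sum>i\<in>I. a i * int (g i)) = 0] (mod int q))"
  using assms
proof (induction Q arbitrary: f M rule: finite_linorder_min_induct)
  case empty
  then show ?case by (intro exI[of _ f]) auto
next
  case (insert p Q)
  have p: "prime p" "coprime p M" using insert.prems by auto
  have nin: "p \<notin> Q" using insert.hyps by auto
  have Qprime: "\<And>q. q \<in> Q \<Longrightarrow> prime q" using insert.prems by auto
  have "2 ^ card Q \<le> \<Prod>Q"
    using Qprime insert.hyps by (intro two_power_card_le_prod) (auto intro: prime_ge_2_nat)
  then have Qless: "card Q < \<Prod>Q" using less_exp[of "card Q"] by linarith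
  have le: "\<Prod>Q \<le> \<Prod>Q * s" using insert.prems by simp
  \<comment> \<open>The primes in \<open>Q\<close> exceed \<open>p\<close>, hence are odd: this is why the smallest prime is treated first.\<close>
  have s3: "\<Prod>Q * s \<ge> 3" if ne: "Q \<noteq> {}"
  proof -
    obtain q where q: "q \<in> Q" using ne by blast
    then have "q > p" "p \<ge> 2" using insert.hyps prime_ge_2_nat[OF p(1)] by auto
    moreover have "q dvd \<Prod>Q" using q insert.hyps by (intro dvd_prodI) auto
    then have "q \<le> \<Prod>Q" using Qless by (intro dvd_imp_le) auto
    ultimately show ?thesis using le by linarith
  qed
  have "equi_fibres f I (p * (\<Prod>Q * s))"
    using insert.prems(5) insert.hyps nin by (simp add: mult.assoc)
  then obtain t :: "'i \<Rightarrow> nat" where t: "\<forall>i\<in>I. t i < p"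
    "equi_fibres (\<lambda>i. (f i, t i)) I (\<Prod>Q * s)"
    "\<forall>q\<in>Q. nonconst a I (\<lambda>i. (f i, t i)) q"
    "\<not> [(\<Sum>i\<in>I. a i * int (f i + M * t i)) = 0] (mod int p)"
    using refine_at_prime[of I Q f p "\<Prod>Q * s" M a] p insert.hyps(1) insert.prems(1,7)
      less_le_trans[OF Qless le] s3 by auto
  define f' where "f' = (\<lambda>i. f i + M * t i)"
  have cop: "coprime q (M * p)" if "q \<in> Q" for q
    using insert.prems(3) that p(1) Qprime[OF that] nin by (auto intro: primes_coprime)
  have "\<exists>g :: 'i \<Rightarrow> nat. (\<forall>i\<in>I. g i < M * p * \<Prod>Q \<and> [g i = f' i] (mod M * p)) \<and>
    equi_fibres g I s \<and> (\<forall>q\<in>Q. \<not> [(\<Sum>i\<in>I. a i * int (g i)) = 0] (mod int q))"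
    using insert.prems(1,4,6) t cop Qprime
    by (intro insert.IH)
      (auto simp: f'_def intro: mixed_radix_less equi_fibres_mixed_radix nonconst_mixed_radix)
  then obtain g where g: "\<forall>i\<in>I. g i < M * p * \<Prod>Q \<and> [g i = f' i] (mod M * p)"
    "equi_fibres g I s" "\<forall>q\<in>Q. \<not> [(\<Sum>i\<in>I. a i * int (g i)) = 0] (mod int q)" by blast
  have "[g i = f i] (mod M)" if "i \<in> I" for i
  proof -
    have "[g i = f' i] (mod M)" using g(1) that by (meson cong_modulus_mult_nat)
    then show ?thesis by (simp add: f'_def cong_def)
  qed
  moreover have "[(\<Sum>i\<in>I. a i * int (g i)) = (\<Sum>i\<in>I. a i * int (f' i))] (mod int p)"
  proof (intro cong_sum cong_mult cong_refl)
    fix i assume "i \<in> I"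
    then have "[g i = f' i] (mod p)"
      using g(1) by (metis cong_modulus_mult_nat mult.commute)
    then show "[int (g i) = int (f' i)] (mod int p)" by (simp add: cong_int_iff)
  qed
  then have "\<not> [(\<Sum>i\<in>I. a i * int (g i)) = 0] (mod int p)"
    using t(4) by (auto simp: f'_def cong_def)
  ultimately show ?case
    using g insert.hyps nin by (intro exI[of _ g]) (auto simp: mult.assoc)
qed

text \<open>The refinement starts from the zero labelling modulo 1, whose only fibre is
  \<open>I\<close>. It fixes \<open>x\<close> modulo \<open>\<Prod>Q\<close>; numbering the
  \<open>s\<close> indices of each fibre then yields a bijection without changing these
  residues.\<close>

lemma exists_bij_weighted_sum_nonzero_mod_primes:
  fixes a :: "'i \<Rightarrow> int" and Q :: "nat set"
  assumes I: "finite I" "card I = n" "n > 0"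
    and Q: "\<And>q. q \<in> Q \<Longrightarrow> prime q" "\<And>q. q \<in> Q \<Longrightarrow> q dvd n"
    and nc: "\<And>q. q \<in> Q \<Longrightarrow> \<exists>i\<in>I. \<exists>j\<in>I. \<not> [a i = a j] (mod int q)"
  shows "\<exists>x. bij_betw x I {0..<n} \<and> (\<forall>q\<in>Q. \<not> [(\<Sum>i\<in>I. a i * int (x i)) = 0] (mod int q))"
proof -
  have finQ: "finite Q"
    by (rule finite_subset[of _ "{..n}"]) (use Q I in \<open>auto intro: dvd_imp_le\<close>)
  \<comment> \<open>\<open>n\<close> is 0 modulo each of the pairwise coprime primes, hence modulo
    their product.\<close>
  have "\<Prod>Q dvd n"
    using finQ Q cong_cong_prod_coprime_nat[of Q n 0 "\<lambda>q. q"]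
    by (simp add: cong_0_iff primes_coprime)
  then obtain s where s: "n = \<Prod>Q * s" by blast
  then have spos: "s > 0" using I by auto
  have "\<exists>g :: 'i \<Rightarrow> nat. (\<forall>i\<in>I. g i < 1 * \<Prod>Q \<and> [g i = 0] (mod 1)) \<and> equi_fibres g I s \<and>
    (\<forall>q\<in>Q. \<not> [(\<Sum>i\<in>I. a i * int (g i)) = 0] (mod int q))"
    using finQ I Q nc s spos
    by (intro refine_at_primes) (auto simp: equi_fibres_def nonconst_def)
  then obtain g where g: "\<And>i. i \<in> I \<Longrightarrow> g i < \<Prod>Q" "equi_fibres g I s"
    "\<And>q. q \<in> Q \<Longrightarrow> \<not> [(\<Sum>i\<in>I. a i * int (g i)) = 0] (mod int q)" by auto
  \<comment> \<open>With no primes to protect and parts of size 1, the splitting numbers each fibre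
    of \<open>g\<close>.\<close>
  obtain t :: "'i \<Rightarrow> nat" where t: "\<forall>i\<in>I. t i < s" "equi_fibres (\<lambda>i. (g i, t i)) I 1"
    using equi_refinement_nonconst[of I "{}" g s 1 a] I g(2) by auto
  define x where "x = (\<lambda>i. g i + \<Prod>Q * t i)"
  have "equi_fibres x I 1"
    unfolding x_def using g t by (intro equi_fibres_mixed_radix) auto
  then have inj: "inj_on x I"
  proof (intro inj_onI)
    fix i j assume "equi_fibres x I 1" "i \<in> I" "j \<in> I" "x i = x j"
    then have "card {k\<in>I. x k = x i} = 1" "i \<in> {k\<in>I. x k = x i}" "j \<in> {k\<in>I. x k = x i}"
      by (auto simp: equi_fibres_def)
    then show "i = j" by (metis card_1_singletonE singletonD)
  qed
  moreover have "x i < n" if "i \<in> I" for i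
    unfolding x_def s using g t that by (intro mixed_radix_less) auto
  then have "x ` I \<subseteq> {0..<n}" by auto
  then have "x ` I = {0..<n}"
    using inj I by (intro card_subset_eq) (auto simp: card_image)
  moreover have "\<not> [(\<Sum>i\<in>I. a i * int (x i)) = 0] (mod int q)" if q: "q \<in> Q" for q
  proof -
    have "q dvd \<Prod>Q" using q finQ by (intro dvd_prodI) auto
    then have "int q dvd int (\<Prod>Q)" by (subst of_nat_dvd_iff)
    then have "[(\<Sum>i\<in>I. a i * int (x i)) = (\<Sum>i\<in>I. a i * int (g i))] (mod int q)"
      by (intro cong_sum cong_mult cong_refl)
        (auto simp: x_def cong_iff_dvd_diff)
    then show ?thesis using g(3)[OF q] by (auto simp: cong_def)
  qed
  ultimately show ?thesis by (auto simp: bij_betw_def)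
qed

section \<open>Scaling to a solution, and the necessary condition\<close>

text \<open>Multiplying \<open>x\<close> by an inverse \<open>u\<close> of the sum makes the sum 1,
  and a unit keeps residues distinct.\<close>

lemma has_distinct_solution_if_coprime:
  fixes x :: "nat \<Rightarrow> nat"
  assumes x: "bij_betw x {1..n} {0..<n}" and cop: "coprime (\<Sum>i=1..n. a i * int (x i)) (int n)"
  shows "has_distinct_solution n a"
proof -
  define S where "S = (\<Sum>i=1..n. a i * int (x i))"
  obtain u where u: "[S * u = 1] (mod int n)"
    using cong_solve_coprime_int cop unfolding S_def by blast
  then have cu: "coprime u (int n)"
    by (metis coprime_iff_invertible_int mult.commute)
  define y where "y = (\<lambda>i. u * int (x i))"
  have "\<not> [y i = y j] (mod int n)" if "i \<in> {1..n}" "j \<in> {1..n}" "i \<noteq> j" for i j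
  proof
    assume "[y i = y j] (mod int n)"
    then have "[int (x i) = int (x j)] (mod int n)"
      unfolding y_def using cu by (simp add: cong_mult_lcancel)
    then have "[x i = x j] (mod n)" by (simp add: cong_int_iff)
    moreover have "x i \<in> {0..<n}" "x j \<in> {0..<n}" using x that by (auto simp: bij_betw_def)
    ultimately have "x i = x j" by (simp add: cong_def)
    then show False using inj_onD[OF bij_betw_imp_inj_on[OF x]] that by blast
  qed
  moreover have "(\<Sum>i=1..n. a i * y i) = S * u"
    by (simp add: S_def y_def sum_distrib_left mult_ac)
  ultimately show ?thesis
    using u unfolding has_distinct_solution_def distinct_mod_def by (intro exI[of _ y]) auto
qed

lemma sum_int_bij_upto:
  assumes "bij_betw x A {0..<n}"
  shows "2 * (\<Sum>i\<in>A. int (x i)) = int n * (int n - 1)"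
proof -
  have "(\<Sum>i\<in>A. int (x i)) = (\<Sum>k=0..<n. int k)"
    using assms by (rule sum.reindex_bij_betw)
  moreover have "2 * (\<Sum>k=0..<n. int k) = int n * (int n - 1)"
    by (induction n) (auto simp: algebra_simps)
  ultimately show ?thesis by simp
qed

text \<open>Reduced modulo \<open>n\<close>, the values run through \<open>0, ..., n - 1\<close>
  once each. \<open>S\<close> is \<open>n(n - 1)/2\<close>, given through its double to avoid
  division.\<close>

lemma distinct_mod_sum:
  assumes "distinct_mod n x"
  shows "\<exists>S. [(\<Sum>i=1..n. x i) = S] (mod int n) \<and> 2 * S = int n * (int n - 1)"
proof (cases "n = 0")
  case True
  then show ?thesis by (intro exI[of _ 0]) auto
next
  case False
  define r where "r = (\<lambda>i. nat (x i mod int n))"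
  have r: "int (r i) = x i mod int n" for i using False by (simp add: r_def)
  have "inj_on r {1..n}"
    using assms by (intro inj_onI) (metis cong_def distinct_mod_def r)
  moreover have "r i < n" for i
    using False pos_mod_bound[of "int n" "x i"] by (simp flip: r)
  then have "r ` {1..n} \<subseteq> {0..<n}" by auto
  ultimately have "bij_betw r {1..n} {0..<n}"
    unfolding bij_betw_def using card_subset_eq[of "{0..<n}" "r ` {1..n}"] by (simp add: card_image)
  moreover have "[(\<Sum>i=1..n. x i) = (\<Sum>i=1..n. int (r i))] (mod int n)"
    by (intro cong_sum) (simp add: r cong_def)
  ultimately show ?thesis using sum_int_bij_upto by blast
qed

lemma dvd_diff_gcd_iff:
  "d dvd diff_gcd n a \<longleftrightarrow> d dvd int n \<and> (\<forall>i\<in>{1..n}. d dvd a i - a 1)"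
proof -
  have "d dvd diff_gcd n a \<longleftrightarrow> d dvd int n \<and> (\<forall>i\<in>{2..n}. d dvd a i - a 1)"
    by (auto simp: diff_gcd_def dvd_Gcd_iff)
  also have "\<dots> \<longleftrightarrow> d dvd int n \<and> (\<forall>i\<in>{1..n}. d dvd a i - a 1)"
  proof -
    have "i = 1 \<or> i \<in> {2..n}" if "i \<in> {1..n}" for i using that by auto
    then show ?thesis by fastforce
  qed
  finally show ?thesis .
qed

text \<open>Modulo \<open>d\<close> every coefficient equals \<open>a 1\<close> and can be pulled
  out of the sum. An arbitrary divisor \<open>d\<close> allows both the whole gcd and 2.\<close>

lemma distinct_solution_cong_sum:
  assumes "distinct_mod n x" "[(\<Sum>i=1..n. a i * x i) = 1] (mod int n)"
    and "d dvd diff_gcd n a"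
  shows "\<exists>S. [a 1 * S = 1] (mod d) \<and> 2 * S = int n * (int n - 1)"
proof -
  obtain S where S: "[(\<Sum>i=1..n. x i) = S] (mod int n)" "2 * S = int n * (int n - 1)"
    using distinct_mod_sum[OF assms(1)] by blast
  have d: "d dvd int n" "\<And>i. i \<in> {1..n} \<Longrightarrow> [a 1 = a i] (mod d)"
    using assms(3) unfolding dvd_diff_gcd_iff by (auto simp: cong_iff_dvd_diff dvd_diff_commute)
  have "[a 1 * S = a 1 * (\<Sum>i=1..n. x i)] (mod d)"
    using S(1) d(1) by (intro cong_mult cong_refl) (meson cong_dvd_modulus cong_sym)
  also have "a 1 * (\<Sum>i=1..n. x i) = (\<Sum>i=1..n. a 1 * x i)" by (simp add: sum_distrib_left)
  also have "[(\<Sum>i=1..n. a 1 * x i) = (\<Sum>i=1..n. a i * x i)] (mod d)"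
    using d(2) by (intro cong_sum cong_mult cong_refl) auto
  also have "[(\<Sum>i=1..n. a i * x i) = 1] (mod d)"
    using assms(2) d(1) by (meson cong_dvd_modulus)
  finally show ?thesis using S(2) by blast
qed

text \<open>Doubling \<open>a 1 * S = 1\<close> brings in \<open>2 * S\<close>, a multiple of
  \<open>n\<close> and so zero modulo the gcd; what remains is 2.\<close>

lemma diff_gcd_dvd_2:
  assumes "has_distinct_solution n a"
  shows "diff_gcd n a dvd 2"
proof -
  let ?d = "diff_gcd n a"
  obtain S where S: "[a 1 * S = 1] (mod ?d)" "2 * S = int n * (int n - 1)"
    using assms distinct_solution_cong_sum[of n _ a ?d] by (auto simp: has_distinct_solution_def)
  have "?d dvd int n" using dvd_diff_gcd_iff[of ?d n a] by simp
  then have "?d dvd a 1 * (2 * S)" unfolding S(2) by simp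
  moreover have "?d dvd 2 * (a 1 * S - 1)" using S(1) by (intro dvd_mult) (simp add: cong_iff_dvd_diff)
  ultimately have "?d dvd a 1 * (2 * S) - 2 * (a 1 * S - 1)" by (rule dvd_diff)
  then show ?thesis by (simp add: algebra_simps)
qed

lemma diff_gcd_eq_1_or_2:
  assumes "has_distinct_solution n a"
  shows "diff_gcd n a = 1 \<or> diff_gcd n a = 2"
proof -
  have "diff_gcd n a \<ge> 0" by (simp add: diff_gcd_def)
  moreover have "diff_gcd n a \<le> 2" "diff_gcd n a \<noteq> 0"
    using diff_gcd_dvd_2[OF assms] zdvd_imp_le by auto
  ultimately show ?thesis by linarith
qed

section \<open>Sufficiency and the three cases\<close>

text \<open>A prime not dividing the gcd separates some \<open>a i\<close> from \<open>a 1\<close>.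
  Modulo a prime that does divide it, the sum is the same for every bijection, so nothing can be
  arranged there.\<close>

lemma exists_bij_sum_nonzero_mod_primes_not_dvd_diff_gcd:
  assumes "n > 0"
  shows "\<exists>x. bij_betw x {1..n} {0..<n} \<and>
    (\<forall>q. prime q \<and> q dvd n \<and> \<not> int q dvd diff_gcd n a \<longrightarrow>
       \<not> int q dvd (\<Sum>i=1..n. a i * int (x i)))"
proof -
  define Q where "Q = {q. prime q \<and> q dvd n \<and> \<not> int q dvd diff_gcd n a}"
  have "\<exists>i\<in>{1..n}. \<exists>j\<in>{1..n}. \<not> [a i = a j] (mod int q)" if "q \<in> Q" for q
  proof -
    have "\<exists>i\<in>{1..n}. \<not> int q dvd a i - a 1"
      using that by (auto simp: Q_def dvd_diff_gcd_iff)
    moreover have "1 \<in> {1..n}" using assms by simp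
    ultimately show ?thesis unfolding cong_iff_dvd_diff by blast
  qed
  then have "\<exists>x. bij_betw x {1..n} {0..<n} \<and>
      (\<forall>q\<in>Q. \<not> [(\<Sum>i=1..n. a i * int (x i)) = 0] (mod int q))"
    using assms by (intro exists_bij_weighted_sum_nonzero_mod_primes) (auto simp: Q_def)
  then show ?thesis by (auto simp: Q_def cong_0_iff)
qed

lemma coprime_int_natI:
  fixes S :: int
  assumes "n > 0" "\<And>q. prime q \<Longrightarrow> q dvd n \<Longrightarrow> \<not> int q dvd S"
  shows "coprime S (int n)"
proof (rule ccontr)
  assume "\<not> coprime S (int n)"
  then have "gcd (nat \<bar>S\<bar>) n \<noteq> 1"
    by (metis abs_ge_zero coprime_abs_left_iff coprime_iff_gcd_eq_1 coprime_int_iff int_nat_eq)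
  then obtain q where "prime q" "q dvd nat \<bar>S\<bar>" "q dvd n"
    using prime_factor_nat by (metis gcd_greatest_iff)
  then show False using assms(2)[of q] by (simp add: dvd_nat_abs_iff)
qed

theorem theorem4p2:
  fixes n :: nat and a :: "nat \<Rightarrow> int"
  assumes "n \<ge> 2"
  shows "(odd n \<or> (\<exists>i\<in>{1..n}. even (a i)) \<longrightarrow>
            (has_distinct_solution n a \<longleftrightarrow> diff_gcd n a = 1)) \<and>
         ([n = 0] (mod 4) \<and> (\<forall>i\<in>{1..n}. odd (a i)) \<longrightarrow>
            \<not> has_distinct_solution n a) \<and>
         ([n = 2] (mod 4) \<and> (\<forall>i\<in>{1..n}. odd (a i)) \<longrightarrow>
            (has_distinct_solution n a \<longleftrightarrow> diff_gcd n a = 2))"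
proof (intro conjI impI)
  assume *: "odd n \<or> (\<exists>i\<in>{1..n}. even (a i))"
  show "has_distinct_solution n a \<longleftrightarrow> diff_gcd n a = 1"
  proof
    assume sol: "has_distinct_solution n a"
    \<comment> \<open>An even gcd would make \<open>n\<close> even and all \<open>a i\<close> of one
      parity, which must then be even; but \<open>a 1 * S\<close> has to be odd.\<close>
    have "\<not> 2 dvd diff_gcd n a"
    proof
      assume d: "2 dvd diff_gcd n a"
      then have "even (int n)" and par: "\<And>i. i \<in> {1..n} \<Longrightarrow> even (a i - a 1)"
        unfolding dvd_diff_gcd_iff by blast+
      then obtain i where "i \<in> {1..n}" "even (a i)" using * by (metis even_of_nat_iff)
      then have "even (a 1)" using par[of i] by simp
      moreover obtain S where "[a 1 * S = 1] (mod 2)"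
        using sol d distinct_solution_cong_sum[of n _ a 2] by (auto simp: has_distinct_solution_def)
      ultimately show False by (auto simp: cong_iff_dvd_diff)
    qed
    then show "diff_gcd n a = 1" using diff_gcd_eq_1_or_2[OF sol] by auto
  next
    assume d: "diff_gcd n a = 1"
    obtain x where x: "bij_betw x {1..n} {0..<n}"
      "\<And>q. prime q \<Longrightarrow> q dvd n \<Longrightarrow> \<not> int q dvd diff_gcd n a \<Longrightarrow>
         \<not> int q dvd (\<Sum>i=1..n. a i * int (x i))"
      using exists_bij_sum_nonzero_mod_primes_not_dvd_diff_gcd[of n a] assms by auto
    have "coprime (\<Sum>i=1..n. a i * int (x i)) (int n)"
    proof (rule coprime_int_natI)
      fix q :: nat assume q: "prime q" "q dvd n"
      then have "q \<noteq> 1" by auto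
      then have "\<not> int q dvd diff_gcd n a" by (simp add: d)
      then show "\<not> int q dvd (\<Sum>i=1..n. a i * int (x i))" using x(2) q by blast
    qed (use assms in simp)
    then show "has_distinct_solution n a" using x(1) by (rule has_distinct_solution_if_coprime[rotated])
  qed
next
  assume *: "[n = 0] (mod 4) \<and> (\<forall>i\<in>{1..n}. odd (a i))"
  then obtain m where m: "n = 4 * m" by (auto simp: cong_0_iff)
  have "2 dvd diff_gcd n a"
    unfolding dvd_diff_gcd_iff using * m assms by auto
  then have S: "\<exists>S. [a 1 * S = 1] (mod 2) \<and> 2 * S = int n * (int n - 1)"
    if "has_distinct_solution n a"
    using that distinct_solution_cong_sum[of n _ a 2] by (auto simp: has_distinct_solution_def)
  show "\<not> has_distinct_solution n a"
  proof
    assume "has_distinct_solution n a"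
    then obtain S where S: "[a 1 * S = 1] (mod 2)" "2 * S = int n * (int n - 1)" using S by blast
    \<comment> \<open>Divisibility of \<open>n\<close> by 4 leaves a factor 2 in
      \<open>n(n - 1)/2\<close>, so \<open>a 1 * S\<close> cannot be odd.\<close>
    have "S = 2 * (int m * (int n - 1))" using S(2) by (simp add: m)
    then show False using S(1) by (auto simp: cong_iff_dvd_diff)
  qed
next
  assume *: "[n = 2] (mod 4) \<and> (\<forall>i\<in>{1..n}. odd (a i))"
  then have n4: "n mod 4 = 2" by (simp add: cong_def)
  define m where "m = n div 4"
  have m: "n = 4 * m + 2" using n4 by (simp add: m_def) presburger
  have even_d: "2 dvd diff_gcd n a"
    unfolding dvd_diff_gcd_iff using * m assms by auto
  show "has_distinct_solution n a \<longleftrightarrow> diff_gcd n a = 2"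
  proof
    assume sol: "has_distinct_solution n a"
    then show "diff_gcd n a = 2" using diff_gcd_eq_1_or_2[OF sol] even_d by auto
  next
    assume d: "diff_gcd n a = 2"
    obtain x where x: "bij_betw x {1..n} {0..<n}"
      "\<And>q. prime q \<Longrightarrow> q dvd n \<Longrightarrow> \<not> int q dvd diff_gcd n a \<Longrightarrow>
         \<not> int q dvd (\<Sum>i=1..n. a i * int (x i))"
      using exists_bij_sum_nonzero_mod_primes_not_dvd_diff_gcd[of n a] assms by auto
    have "\<not> int q dvd (\<Sum>i=1..n. a i * int (x i))" if q: "prime q" "q dvd n" for q
    proof (cases "q = 2")
      case False
      then have "\<not> q dvd 2" using q two_is_prime_nat primes_dvd_imp_eq by blast
      then have "\<not> int q dvd 2" by (metis of_nat_dvd_iff of_nat_numeral)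
      then show ?thesis using x(2) q d by auto
    next
      case True
      \<comment> \<open>The construction says nothing at the prime 2, which divides the gcd. Here
        any bijection works: odd coefficients count as 1, and \<open>n(n - 1)/2\<close> is odd for
        \<open>n = 4 * m + 2\<close>.\<close>
      have "[(\<Sum>i=1..n. a i * int (x i)) = (\<Sum>i=1..n. 1 * int (x i))] (mod 2)"
        using * by (intro cong_sum cong_mult cong_refl) (auto simp: cong_iff_dvd_diff)
      moreover have "(\<Sum>i=1..n. int (x i)) = (2 * int m + 1) * (4 * int m + 1)"
        using sum_int_bij_upto[OF x(1)] by (simp add: m algebra_simps)
      ultimately have "[(\<Sum>i=1..n. a i * int (x i)) = (2 * int m + 1) * (4 * int m + 1)] (mod 2)"
        by simp
      then show ?thesis using True by (auto dest: cong_dvd_iff)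
    qed
    then have "coprime (\<Sum>i=1..n. a i * int (x i)) (int n)"
      using assms by (intro coprime_int_natI) auto
    then show "has_distinct_solution n a" using x(1) by (rule has_distinct_solution_if_coprime[rotated])
  qed
qed

end
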